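(* Let $r\ge 2$ and $n\ge 1$ be integers with $r^2\mid n$, and assume that a Steiner system $S(2,r,r^2)$ exists. Then $$ex_r^{\mathrm{lin}}(n,P_4^r)\ge \frac{(r+1)n}{r}.$$
   Context: All hypergraphs are finite. A hypergraph is $r$-uniform if each hyperedge has exactly $r$ vertices, and linear if any two distinct hyperedges intersect in at most one vertex. A hypergraph $H$ contains $F$ as a subhypergraph if there is an injective map $V(F)\to V(H)$ sending every hyperedge of $F$ to a hyperedge of $H$; otherwise $H$ is $F$-free. The linear Turán number $ex_r^{\mathrm{lin}}(n,F)$ is the maximum number of hyperedges in an $F$-free linear $r$-uniform hypergraph on $n$ vertices. The expansion $G^r$ of a graph $G$ is the $r$-uniform hypergraph obtained by enlarging each edge of $G$ with $r-2$ new vertices, the new vertices for different edges being distinct. $P_4$ is the path with four edges (five vertices) and $P_4^r$ is its expansion; explicitly, four hyperedges $e_1,e_2,e_3,e_4$ of size $r$ such that consecutive ones meet in exactly one vertex, these three intersection vertices are distinct, and non-consecutive ones are disjoint. A Steiner system $S(2,r,m)$ is a set of $m$ vertices together with a family of $r$-element subsets (blocks, viewed as hyperedges) such that every pair of distinct vertices lies in exactly one block. *)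

theory Defs
  imports Complex_Main
begin

type_synonym 'a hypergraph = "'a set \<times> 'a set set"

abbreviation verts :: "'a hypergraph \<Rightarrow> 'a set" where
  "verts H \<equiv> fst H"

abbreviation hedges :: "'a hypergraph \<Rightarrow> 'a set set" where
  "hedges H \<equiv> snd H"

definition hypergraph :: "'a hypergraph \<Rightarrow> bool" where
  "hypergraph H \<longleftrightarrow> finite (verts H) \<and> (\<forall>e\<in>hedges H. e \<subseteq> verts H)"

definition uniform :: "nat \<Rightarrow> 'a hypergraph \<Rightarrow> bool" where
  "uniform r H \<longleftrightarrow> (\<forall>e\<in>hedges H. card e = r)"

definition linear_hg :: "'a hypergraph \<Rightarrow> bool" where
  "linear_hg H \<longleftrightarrow> (\<forall>e\<in>hedges H. \<forall>f\<in>hedges H. e \<noteq> f \<longrightarrow> card (e \<inter> f) \<le> 1)"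

definition contains_hg :: "'a hypergraph \<Rightarrow> 'b hypergraph \<Rightarrow> bool" where
  "contains_hg H F \<longleftrightarrow>
     (\<exists>\<phi>. inj_on \<phi> (verts F) \<and> \<phi> ` verts F \<subseteq> verts H \<and> (\<forall>e\<in>hedges F. \<phi> ` e \<in> hedges H))"

definition lin_free :: "nat \<Rightarrow> nat \<Rightarrow> 'b hypergraph \<Rightarrow> nat hypergraph \<Rightarrow> bool" where
  "lin_free r n F H \<longleftrightarrow> hypergraph H \<and> card (verts H) = n \<and> uniform r H \<and> linear_hg H
     \<and> \<not> contains_hg H F"

text \<open>The hosts have vertices in \<^typ>\<open>nat\<close>; since all hypergraphs are finite, this covers every
  hypergraph up to isomorphism. The maximum is over a finite set, and over a nonempty one as soon
  as \<open>F\<close> has a hyperedge; see the two lemmas below.\<close>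

definition ex_lin :: "nat \<Rightarrow> nat \<Rightarrow> 'b hypergraph \<Rightarrow> nat" where
  "ex_lin r n F = Max {card (hedges H) |H. lin_free r n F H}"

lemma finite_ex_lin_set: "finite {card (hedges H) |H. lin_free r n F H}"
proof (rule finite_subset)
  show "{card (hedges H) |H. lin_free r n F H} \<subseteq> {..2 ^ n}"
  proof clarsimp
    fix V E assume "lin_free r n F (V, E)"
    then have "finite V" "card V = n" "E \<subseteq> Pow V"
      by (auto simp: lin_free_def hypergraph_def)
    then show "card E \<le> 2 ^ n"
      using card_mono[of "Pow V" E] by (simp add: card_Pow)
  qed
qed simp

lemma ex_lin_set_nonempty:
  assumes "hedges F \<noteq> {}"
  shows "{card (hedges H) |H. lin_free r n F H} \<noteq> {}"
proof -
  have "lin_free r n F ({..<n}, {})"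
    using assms by (auto simp: lin_free_def hypergraph_def uniform_def linear_hg_def contains_hg_def)
  then show ?thesis by blast
qed

text \<open>In the expansion of \<open>G\<close>, the vertex \<open>Inr (e, i)\<close> is the \<open>i\<close>-th new vertex added to the
  edge \<open>e\<close>. A graph is a 2-uniform hypergraph.\<close>

definition expansion :: "nat \<Rightarrow> 'a hypergraph \<Rightarrow> ('a + 'a set \<times> nat) hypergraph" where
  "expansion r G =
     (Inl ` verts G \<union> Inr ` (hedges G \<times> {..<r - 2}),
      (\<lambda>e. Inl ` e \<union> Inr ` ({e} \<times> {..<r - 2})) ` hedges G)"

text \<open>The path with \<open>k\<close> edges and \<open>k + 1\<close> vertices.\<close>

definition path_graph :: "nat \<Rightarrow> nat hypergraph" where
  "path_graph k = ({..k}, (\<lambda>i. {i, Suc i}) ` {..<k})"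

text \<open>Steiner systems \<open>S(2, r, m)\<close>.\<close>

definition steiner_system2 :: "nat \<Rightarrow> nat \<Rightarrow> 'a hypergraph \<Rightarrow> bool" where
  "steiner_system2 r m S \<longleftrightarrow> hypergraph S \<and> card (verts S) = m \<and> uniform r S
     \<and> (\<forall>x\<in>verts S. \<forall>y\<in>verts S. x \<noteq> y \<longrightarrow> (\<exists>!B. B \<in> hedges S \<and> x \<in> B \<and> y \<in> B))"

end

(* A Steiner system S(2, r, r^2) is an affine plane of order r. In it, two lines through a point x
   cannot both miss a line L not through x: the r lines joining x to the points of L together with
   these two lines would cover (r + 2)(r - 1) > r^2 - 1 further points. If the plane contained an
   expanded path e1, e2, e3, e4, then e3 and e4 would both miss e1 and share a point. Hence
   disjoint copies of the plane are P_4^r-free, and each has r(r + 1) lines by counting ordered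
   pairs of points. *)

theory Submission
  imports Defs
begin

text \<open>Hosts counted by \<open>ex_lin\<close> have vertices in \<open>nat\<close>. Relabelling
  along an injection into \<open>nat\<close> makes a host over any vertex type give a lower bound,
  so the construction can use pairs as vertices.\<close>

lemma ex_lin_ge:
  fixes H :: "'b hypergraph" and F :: "'c hypergraph"
  assumes "hypergraph H" and card: "card (verts H) = n" and "uniform r H" and "linear_hg H"
    and free: "\<not> contains_hg H F"
  shows "card (hedges H) \<le> ex_lin r n F"
proof -
  have fin: "finite (verts H)" and sub: "\<And>e. e \<in> hedges H \<Longrightarrow> e \<subseteq> verts H"
    using assms(1) by (auto simp: hypergraph_def)
  obtain g :: "'b \<Rightarrow> nat" where inj: "inj_on g (verts H)"
    using finite_imp_inj_to_nat_seg[OF fin] by blast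
  define K where "K = (g ` verts H, (`) g ` hedges H)"
  have injE: "inj_on ((`) g) (hedges H)"
    using inj sub by (auto intro!: inj_onI simp: inj_on_image_eq_iff)
  have "hypergraph K"
    using fin sub by (auto simp: K_def hypergraph_def)
  moreover have "card (verts K) = n"
    using card inj by (simp add: K_def card_image)
  moreover have "uniform r K"
    using assms(3) inj sub by (auto simp: K_def uniform_def card_image inj_on_subset)
  moreover have "linear_hg K"
    unfolding linear_hg_def
  proof (intro ballI impI)
    fix e f assume "e \<in> hedges K" "f \<in> hedges K" "e \<noteq> f"
    then obtain e' f' where ef: "e' \<in> hedges H" "f' \<in> hedges H" "e = g ` e'" "f = g ` f'" "e' \<noteq> f'"
      by (auto simp: K_def)
    then have "e \<inter> f = g ` (e' \<inter> f')"
      using inj sub by (simp add: inj_on_image_Int)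
    also have "card \<dots> \<le> card (e' \<inter> f')"
      using fin sub ef by (meson card_image_le finite_Int finite_subset)
    also have "\<dots> \<le> 1"
      using ef assms(4) by (auto simp: linear_hg_def)
    finally show "card (e \<inter> f) \<le> 1" .
  qed
  moreover have "\<not> contains_hg K F"
  proof
    assume "contains_hg K F"
    then obtain \<phi> where \<phi>: "inj_on \<phi> (verts F)" "\<phi> ` verts F \<subseteq> g ` verts H"
      "\<And>e. e \<in> hedges F \<Longrightarrow> \<phi> ` e \<in> (`) g ` hedges H"
      by (auto simp: contains_hg_def K_def)
    \<comment> \<open>Undoing the relabelling turns an embedding of \<open>F\<close> into
      \<open>K\<close> into one into \<open>H\<close>.\<close>
    let ?\<psi> = "inv_into (verts H) g \<circ> \<phi>"
    have "inj_on ?\<psi> (verts F)"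
      using \<phi> by (meson comp_inj_on inj_on_inv_into)
    moreover have "?\<psi> ` verts F \<subseteq> verts H"
      using \<phi>(2) by (auto simp: image_subset_iff intro!: inv_into_into)
    moreover have "?\<psi> ` e \<in> hedges H" if e: "e \<in> hedges F" for e
    proof -
      obtain e' where "e' \<in> hedges H" "\<phi> ` e = g ` e'"
        using \<phi>(3)[OF e] by blast
      then show ?thesis
        using inj sub by (metis image_comp inv_into_image_cancel)
    qed
    ultimately show False
      using free unfolding contains_hg_def by blast
  qed
  ultimately have "lin_free r n F K"
    by (simp add: lin_free_def)
  moreover have "card (hedges K) = card (hedges H)"
    using injE by (simp add: K_def card_image)
  ultimately show ?thesis
    unfolding ex_lin_def by (intro Max_ge[OF finite_ex_lin_set] CollectI exI[of _ K]) simp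
qed

text \<open>Reduces an embedded path to the incidence pattern of its four hyperedges. Meeting
  survives under any map; disjointness survives because \<open>\<phi>\<close> is injective.\<close>

lemma contains_expansion_path4E:
  assumes "contains_hg H (expansion r (path_graph 4))"
  obtains e1 e2 e3 e4 where "e1 \<in> hedges H" "e2 \<in> hedges H" "e3 \<in> hedges H" "e4 \<in> hedges H"
    "e1 \<inter> e2 \<noteq> {}" "e2 \<inter> e3 \<noteq> {}" "e3 \<inter> e4 \<noteq> {}"
    "e1 \<inter> e3 = {}" "e1 \<inter> e4 = {}" "e2 \<inter> e4 = {}"
proof -
  let ?F = "expansion r (path_graph 4)"
  define a :: "nat \<Rightarrow> (nat + nat set \<times> nat) set"
    where "a i = Inl ` {i, Suc i} \<union> Inr ` ({{i, Suc i}} \<times> {..<r - 2})" for i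
  obtain \<phi> where inj: "inj_on \<phi> (verts ?F)"
    and edges: "\<And>e. e \<in> hedges ?F \<Longrightarrow> \<phi> ` e \<in> hedges H"
    using assms by (auto simp: contains_hg_def)
  have a: "a i \<in> hedges ?F" "a i \<subseteq> verts ?F" if "i < 4" for i
    using that by (force simp: expansion_def path_graph_def a_def image_image)+
  \<comment> \<open>The old vertex \<open>Inl (Suc i)\<close> lies in both enlarged edges.\<close>
  have meet: "\<phi> ` a i \<inter> \<phi> ` a (Suc i) \<noteq> {}" for i
    by (auto simp: a_def)
  have disj: "\<phi> ` a i \<inter> \<phi> ` a j = {}" if "Suc i < j" "j < 4" for i j
  proof -
    \<comment> \<open>The old vertices differ because \<open>Suc i < j\<close>, the new ones because
      they are tagged with different edges.\<close>
    have "a i \<inter> a j = {}"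
      using that by (auto simp: a_def doubleton_eq_iff)
    then show ?thesis
      using inj a[of i] a[of j] that by (metis Suc_lessD image_empty inj_on_image_Int less_trans)
  qed
  show thesis
    using that[of "\<phi> ` a 0" "\<phi> ` a 1" "\<phi> ` a 2" "\<phi> ` a 3"] edges a meet[of 0] meet[of 1] meet[of 2]
      disj[of 0 2] disj[of 0 3] disj[of 1 3]
    by (simp add: numeral_eq_Suc)
qed

text \<open>Two blocks sharing two points would break the uniqueness of the block through a
  pair.\<close>

lemma steiner_system2_linear:
  assumes S: "steiner_system2 r m S"
  shows "linear_hg S"
  unfolding linear_hg_def
proof (intro ballI impI)
  fix e f assume ef: "e \<in> hedges S" "f \<in> hedges S" "e \<noteq> f"
  then have sub: "e \<subseteq> verts S" "f \<subseteq> verts S" and "finite (verts S)"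
    using S by (auto simp: steiner_system2_def hypergraph_def)
  then have "finite (e \<inter> f)"
    by (meson finite_Int finite_subset)
  moreover have "x = y" if "x \<in> e \<inter> f" "y \<in> e \<inter> f" for x y
    using that ef sub S unfolding steiner_system2_def by blast
  ultimately show "card (e \<inter> f) \<le> 1"
    by (simp add: card_le_Suc0_iff_eq)
qed

text \<open>Double counting of ordered pairs of distinct points: each lies in exactly one block, and
  a block holds \<open>r * (r - 1)\<close> of them.\<close>

lemma steiner_system2_card_blocks:
  assumes S: "steiner_system2 r m S"
  shows "card (hedges S) * (r * (r - 1)) = m * (m - 1)"
proof -
  define D where "D A = A \<times> A - Id_on A" for A :: "'a set"
  have card_D: "card (D A) = card A * (card A - 1)" if "finite A" for A
  proof -
    have "Id_on A = (\<lambda>x. (x, x)) ` A"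
      by auto
    then have "card (Id_on A) = card A"
      by (simp add: card_image inj_on_def)
    moreover have "Id_on A \<subseteq> A \<times> A"
      by auto
    ultimately show ?thesis
      using that by (simp add: D_def card_Diff_subset finite_subset card_cartesian_product
          right_diff_distrib')
  qed
  have fin: "finite (verts S)" and sub: "\<And>B. B \<in> hedges S \<Longrightarrow> B \<subseteq> verts S \<and> card B = r"
    using S by (auto simp: steiner_system2_def hypergraph_def uniform_def)
  have finB: "finite B" if "B \<in> hedges S" for B
    using that fin sub finite_subset by blast
  have "finite (hedges S)"
    using fin sub by (meson Pow_iff finite_Pow_iff finite_subset subsetI)
  moreover have "D (verts S) = (\<Union>B\<in>hedges S. D B)"
  proof
    show "D (verts S) \<subseteq> (\<Union>B\<in>hedges S. D B)"
    proof clarify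
      fix x y assume "(x, y) \<in> D (verts S)"
      then have "x \<in> verts S" "y \<in> verts S" "x \<noteq> y"
        by (auto simp: D_def)
      then obtain B where "B \<in> hedges S" "x \<in> B" "y \<in> B"
        using S unfolding steiner_system2_def by blast
      then show "(x, y) \<in> (\<Union>B\<in>hedges S. D B)"
        using \<open>x \<noteq> y\<close> by (auto simp: D_def)
    qed
    show "(\<Union>B\<in>hedges S. D B) \<subseteq> D (verts S)"
      unfolding D_def using sub by blast
  qed
  \<comment> \<open>A common pair would give two common points, against linearity.\<close>
  moreover have "D B \<inter> D C = {}" if "B \<in> hedges S" "C \<in> hedges S" "B \<noteq> C" for B C
  proof (rule equals0I, clarify)
    fix x y assume "(x, y) \<in> D B" "(x, y) \<in> D C"
    then have "x \<in> B \<inter> C" "y \<in> B \<inter> C" "x \<noteq> y"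
      by (auto simp: D_def)
    moreover have "card (B \<inter> C) \<le> Suc 0"
      using steiner_system2_linear[OF S] that by (auto simp: linear_hg_def)
    ultimately show False
      using finB[OF that(1)] by (simp add: card_le_Suc0_iff_eq)
  qed
  ultimately have "card (D (verts S)) = (\<Sum>B\<in>hedges S. card (D B))"
    using finB by (simp add: card_UN_disjoint D_def)
  then show ?thesis
    using S fin finB sub by (simp add: card_D steiner_system2_def)
qed

text \<open>Uniqueness of parallels in an affine plane of order \<open>r\<close>: otherwise
  \<open>r + 2\<close> lines through \<open>x\<close> would need more points than there are.\<close>

lemma affine_plane_parallel_unique:
  assumes S: "steiner_system2 r (r\<^sup>2) S" and r: "r \<ge> 2"
    and L: "L \<in> hedges S" "L1 \<in> hedges S" "L2 \<in> hedges S"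
    and disj: "L \<inter> L1 = {}" "L \<inter> L2 = {}" and x: "x \<in> L1" "x \<in> L2"
  shows "L1 = L2"
proof (rule ccontr)
  assume "L1 \<noteq> L2"
  have fin: "finite (verts S)" and card: "card (verts S) = r\<^sup>2"
    and sub: "\<And>B. B \<in> hedges S \<Longrightarrow> B \<subseteq> verts S \<and> card B = r"
    and ex1: "\<And>u v. u \<in> verts S \<Longrightarrow> v \<in> verts S \<Longrightarrow> u \<noteq> v \<Longrightarrow>
      \<exists>!B. B \<in> hedges S \<and> u \<in> B \<and> v \<in> B"
    using S by (auto simp: steiner_system2_def hypergraph_def uniform_def)
  have finB: "finite B" if "B \<in> hedges S" for B
    using that fin sub finite_subset by blast
  have xV: "x \<in> verts S" and xL: "x \<notin> L"
    using x L sub disj by auto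
  have "\<forall>y\<in>L. \<exists>B. B \<in> hedges S \<and> x \<in> B \<and> y \<in> B"
    using xV xL L(1) sub ex1 by (metis subsetD)
  then obtain j where j: "\<And>y. y \<in> L \<Longrightarrow> j y \<in> hedges S \<and> x \<in> j y \<and> y \<in> j y"
    by metis
  \<comment> \<open>\<open>j y\<close> joins \<open>x\<close> to \<open>y\<close>. If it also passed
    through another point of \<open>L\<close>, it would be \<open>L\<close>, which misses
    \<open>x\<close>.\<close>
  have inj: "inj_on j L"
  proof (rule inj_onI, rule ccontr)
    fix y z assume yz: "y \<in> L" "z \<in> L" "j y = j z" "y \<noteq> z"
    then have "j y = L"
      using ex1[of y z] j[of y] j[of z] L(1) sub by (metis subsetD)
    then show False
      using j yz xL by metis
  qed
  define \<B> where "\<B> = insert L1 (insert L2 (j ` L))"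
  have \<B>: "\<And>B. B \<in> \<B> \<Longrightarrow> B \<in> hedges S \<and> x \<in> B"
    using j x L by (auto simp: \<B>_def)
  have fin\<B>: "finite \<B>"
    using finB[OF L(1)] by (simp add: \<B>_def)
  \<comment> \<open>Each joining line meets \<open>L\<close>, whereas \<open>L1\<close> and
    \<open>L2\<close> miss it.\<close>
  have "L1 \<notin> j ` L" "L2 \<notin> j ` L"
    using disj j by blast+
  then have card\<B>: "card \<B> = r + 2"
    using \<open>L1 \<noteq> L2\<close> finB[OF L(1)] sub[OF L(1)] inj by (simp add: \<B>_def card_image)
  \<comment> \<open>Distinct lines through \<open>x\<close> share no further point, so the lines
    with \<open>x\<close> removed can be counted by a sum.\<close>
  have "(B - {x}) \<inter> (C - {x}) = {}" if "B \<in> \<B>" "C \<in> \<B>" "B \<noteq> C" for B C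
  proof (rule equals0I)
    fix y assume "y \<in> (B - {x}) \<inter> (C - {x})"
    then have y: "y \<in> B" "y \<in> C" "x \<noteq> y"
      by auto
    moreover from y have "y \<in> verts S"
      using \<B> sub that by blast
    ultimately show False
      using ex1[OF xV] \<B> that by blast
  qed
  then have "card (\<Union>B\<in>\<B>. B - {x}) = (\<Sum>B\<in>\<B>. card (B - {x}))"
    using fin\<B> finB \<B> by (intro card_UN_disjoint) auto
  also have "\<dots> = (r + 2) * (r - 1)"
    using \<B> finB sub card\<B> by simp
  finally have "(r + 2) * (r - 1) = card (\<Union>B\<in>\<B>. B - {x})" ..
  also have "\<dots> \<le> card (verts S - {x})"
    using fin \<B> sub by (intro card_mono) auto
  also have "\<dots> = r\<^sup>2 - 1"
    using fin xV card by simp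
  finally have "(r + 2) * (r - 1) \<le> r\<^sup>2 - 1" .
  \<comment> \<open>This substitution removes the truncated subtractions; the left side then exceeds
    the right by \<open>k + 1\<close>.\<close>
  moreover obtain k where "r = k + 2"
    using r by (metis add.commute le_Suc_ex)
  ultimately show False
    by (simp add: power2_eq_square)
qed

text \<open>Tagging the vertices with an index below \<open>m\<close> keeps the copies
  vertex-disjoint.\<close>

definition copies :: "nat \<Rightarrow> 'a hypergraph \<Rightarrow> (nat \<times> 'a) hypergraph" where
  "copies m H = ({..<m} \<times> verts H, (\<lambda>(k, B). {k} \<times> B) ` ({..<m} \<times> hedges H))"

lemma hypergraph_copies: "hypergraph H \<Longrightarrow> hypergraph (copies m H)"
  by (auto simp: hypergraph_def copies_def)

lemma card_verts_copies: "card (verts (copies m H)) = m * card (verts H)"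
  by (simp add: copies_def card_cartesian_product)

lemma uniform_copies: "uniform r H \<Longrightarrow> uniform r (copies m H)"
  by (auto simp: uniform_def copies_def card_cartesian_product)

lemma linear_copies:
  assumes "linear_hg H"
  shows "linear_hg (copies m H)"
proof -
  have "card (({k} \<times> B) \<inter> ({l} \<times> C)) \<le> 1"
    if "B \<in> hedges H" "C \<in> hedges H" "{k} \<times> B \<noteq> {l} \<times> C" for k l :: nat and B C
  proof (cases "k = l")
    case True
    then have "({k} \<times> B) \<inter> ({l} \<times> C) = {k} \<times> (B \<inter> C)" and "B \<noteq> C"
      using that by auto
    then show ?thesis
      using assms that by (simp add: linear_hg_def card_cartesian_product)
  next
    case False
    then have "({k} \<times> B) \<inter> ({l} \<times> C) = {}"
      by auto
    then show ?thesis
      by simp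
  qed
  then show ?thesis
    by (fastforce simp: linear_hg_def copies_def)
qed

text \<open>An empty hyperedge would be the same set in every copy; for nonempty ones the tag can be
  recovered.\<close>

lemma card_hedges_copies:
  assumes "{} \<notin> hedges H"
  shows "card (hedges (copies m H)) = m * card (hedges H)"
proof -
  have "inj_on (\<lambda>(k, B). {k} \<times> B) ({..<m} \<times> hedges H)"
    using assms by (auto simp: inj_on_def times_eq_iff)
  then show ?thesis
    by (simp add: copies_def card_image card_cartesian_product)
qed

text \<open>In a single plane the third and fourth lines of the path share a point and both miss the
  first, hence coincide; but the second line meets the third and misses the fourth.\<close>

lemma copies_affine_plane_path4_free:
  assumes S: "steiner_system2 r (r\<^sup>2) S" and r: "r \<ge> 2"
  shows "\<not> contains_hg (copies m S) (expansion r (path_graph 4))"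
proof
  assume "contains_hg (copies m S) (expansion r (path_graph 4))"
  then obtain e1 e2 e3 e4 where e: "e1 \<in> hedges (copies m S)" "e2 \<in> hedges (copies m S)"
    "e3 \<in> hedges (copies m S)" "e4 \<in> hedges (copies m S)"
    and meet: "e1 \<inter> e2 \<noteq> {}" "e2 \<inter> e3 \<noteq> {}" "e3 \<inter> e4 \<noteq> {}"
    and disj: "e1 \<inter> e3 = {}" "e1 \<inter> e4 = {}" "e2 \<inter> e4 = {}"
    by (rule contains_expansion_path4E)
  obtain k1 k2 k3 k4 B1 B2 B3 B4
    where B: "B1 \<in> hedges S" "B2 \<in> hedges S" "B3 \<in> hedges S" "B4 \<in> hedges S"
      and eq: "e1 = {k1} \<times> B1" "e2 = {k2} \<times> B2" "e3 = {k3} \<times> B3" "e4 = {k4} \<times> B4"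
    using e by (auto simp: copies_def)
  \<comment> \<open>Consecutive hyperedges meet, so the whole path stays in one copy.\<close>
  have k: "k2 = k1" "k3 = k1" "k4 = k1"
    using meet eq by auto
  then obtain x where "x \<in> B3" "x \<in> B4"
    using meet eq by auto
  moreover have "B1 \<inter> B3 = {}" "B1 \<inter> B4 = {}"
    using disj eq k by auto
  ultimately have "B3 = B4"
    using affine_plane_parallel_unique[OF S r] B by blast
  then show False
    using meet(2) disj(3) eq k by simp
qed

theorem theorem5:
  fixes r n :: nat
  assumes "r \<ge> 2" and "n \<ge> 1" and "r\<^sup>2 dvd n"
    and "\<exists>S :: 'a hypergraph. steiner_system2 r (r\<^sup>2) S"
  shows "real (ex_lin r n (expansion r (path_graph 4))) \<ge> (real r + 1) * real n / real r"
proof -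
  obtain S :: "'a hypergraph" where S: "steiner_system2 r (r\<^sup>2) S"
    using assms(4) by blast
  \<comment> \<open>With \<open>m\<close> copies of the plane the host has exactly \<open>n\<close>
    vertices.\<close>
  obtain m where n: "n = m * r\<^sup>2"
    using assms(3) by (metis dvd_def mult.commute)
  have hS: "hypergraph S" "card (verts S) = r\<^sup>2" "uniform r S"
    using S by (auto simp: steiner_system2_def)
  \<comment> \<open>The pair count is factored so that \<open>r * (r - 1)\<close>, nonzero for
    \<open>r \<ge> 2\<close>, can be cancelled.\<close>
  have "card (hedges S) * (r * (r - 1)) = (r * (r + 1)) * (r * (r - 1))"
  proof -
    have "r\<^sup>2 - 1 = (r + 1) * (r - 1)"
      by (simp add: power2_eq_square algebra_simps)
    then have "card (hedges S) * (r * (r - 1)) = r\<^sup>2 * ((r + 1) * (r - 1))"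
      using steiner_system2_card_blocks[OF S] by simp
    then show ?thesis
      by (simp only: power2_eq_square mult_ac)
  qed
  then have "card (hedges S) = r * (r + 1)"
    using assms(1) by simp
  moreover have "{} \<notin> hedges S"
    using hS(3) assms(1) by (auto simp: uniform_def)
  ultimately have "m * (r * (r + 1)) = card (hedges (copies m S))"
    by (simp add: card_hedges_copies)
  also have "\<dots> \<le> ex_lin r n (expansion r (path_graph 4))"
    using S hS n assms(1)
    by (intro ex_lin_ge hypergraph_copies uniform_copies linear_copies steiner_system2_linear
        copies_affine_plane_path4_free) (simp_all add: card_verts_copies)
  finally have "real (m * (r * (r + 1))) \<le> real (ex_lin r n (expansion r (path_graph 4)))"
    by (rule of_nat_mono)
  \<comment> \<open>Since \<open>n\<close> is \<open>m\<close> times the square of \<open>r\<close>,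
    the claimed bound is exactly the number of hyperedges of the host.\<close>
  moreover have "(real r + 1) * real n / real r = real (m * (r * (r + 1)))"
    using assms(1) by (simp add: n power2_eq_square field_simps)
  ultimately show ?thesis
    by simp
qed

end
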